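(* Let $P=([n],\preceq)$ be a poset, $w$ a weight on $\mathbb{F}_q$, and let $k_i=k$ for all $i\in[n]$, $N=nk$. Let $\mathbb{C}\subseteq\mathbb{F}_q^N$ be a code with $|\mathbb{C}|\ge2$ and minimum distance $d_{(P,w,\pi)}(\mathbb{C})$. If $\mathbb{C}$ is MDS, then $$M_w\Big(n-\frac{\lceil\log_q|\mathbb{C}|\rceil}{k}\Big)+1\le d_{(P,w,\pi)}(\mathbb{C})\le M_w\Big(n-\frac{\lceil\log_q|\mathbb{C}|\rceil}{k}+1\Big).$$
   Context: A weight on $\mathbb{F}_q$ is a map $w:\mathbb{F}_q\to\mathbb{N}\cup\{0\}$ with $w(\alpha)=0$ iff $\alpha=0$, $w(-\alpha)=w(\alpha)$, $w(\alpha+\beta)\le w(\alpha)+w(\beta)$; $M_w=\max_\alpha w(\alpha)$; $\tilde w^k(v)=\max_s w(v_s)$. Ideals of $P$ are down-closed subsets; $\langle A\rangle$ is the generated ideal; $\mathcal{I}^r$ is the set of ideals of cardinality $r$. For $x=x_1\oplus\cdots\oplus x_n\in(\mathbb{F}_q^k)^{\oplus n}$, $supp_\pi(x)=\{i:x_i\ne0\}$, $I_x=\langle supp_\pi(x)\rangle$, $M_x$ its maximal elements, $w_{(P,w,\pi)}(x)=\sum_{i\in M_x}\tilde w^{k}(x_i)+|I_x\setminus M_x|\,M_w$, $d_{(P,w,\pi)}(x,y)=w_{(P,w,\pi)}(x-y)$, and $d_{(P,w,\pi)}(\mathbb{C})$ is the minimum distance between distinct codewords. $\mathbb{C}$ is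 MDS if $\max_{J\in\mathcal{I}^r}\{\sum_{i\in J}k_i\}=N-\lceil\log_q|\mathbb{C}|\rceil$ where $r=\lfloor(d_{(P,w,\pi)}(\mathbb{C})-1)/M_w\rfloor$. *)

theory Defs
  imports Complex_Main "HOL-Library.Cardinality" "Jordan_Normal_Form.Matrix"
begin

text \<open>A poset on \<open>[n] = {1..n}\<close> is a relation \<open>P\<close> with \<open>partial_order_on {1..n} P\<close>, where
  \<open>(i, j) \<in> P\<close> reads \<open>i \<preceq> j\<close>. The finite field with \<open>q\<close> elements is a type of class
  \<open>{field, finite}\<close> with \<open>q = CARD('a)\<close>.\<close>

definition is_weight :: "('a::{field,finite} \<Rightarrow> nat) \<Rightarrow> bool" where
  "is_weight w \<longleftrightarrow>
     (\<forall>\<alpha>. w \<alpha> = 0 \<longleftrightarrow> \<alpha> = 0) \<and> (\<forall>\<alpha>. w (- \<alpha>) = w \<alpha>) \<and>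
     (\<forall>\<alpha> \<beta>. w (\<alpha> + \<beta>) \<le> w \<alpha> + w \<beta>)"

definition max_weight :: "('a::{field,finite} \<Rightarrow> nat) \<Rightarrow> nat" where
  "max_weight w = Max (range w)"

text \<open>The weight \<open>\<tilde>w\<^sup>k\<close> on blocks, with \<open>k = dim_vec v\<close>; only meaningful for \<open>k \<ge> 1\<close>.\<close>

definition block_weight :: "('a::{field,finite} \<Rightarrow> nat) \<Rightarrow> 'a vec \<Rightarrow> nat" where
  "block_weight w v = Max ((\<lambda>s. w (v $ s)) ` {..<dim_vec v})"

definition is_ideal :: "nat \<Rightarrow> nat rel \<Rightarrow> nat set \<Rightarrow> bool" where
  "is_ideal n P J \<longleftrightarrow> J \<subseteq> {1..n} \<and> (\<forall>j\<in>J. \<forall>i. (i, j) \<in> P \<longrightarrow> i \<in> J)"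

definition ideals_of_card :: "nat \<Rightarrow> nat rel \<Rightarrow> nat \<Rightarrow> nat set set" where
  "ideals_of_card n P r = {J. is_ideal n P J \<and> card J = r}"

definition generated_ideal :: "nat \<Rightarrow> nat rel \<Rightarrow> nat set \<Rightarrow> nat set" where
  "generated_ideal n P A = \<Inter> {J. is_ideal n P J \<and> A \<subseteq> J}"

definition maximal_elements :: "nat rel \<Rightarrow> nat set \<Rightarrow> nat set" where
  "maximal_elements P A = {i \<in> A. \<forall>j\<in>A. (i, j) \<in> P \<longrightarrow> j = i}"

text \<open>A label map \<open>ks\<close> (block lengths \<open>k\<^sub>i = ks i\<close>, \<open>i \<in> [n]\<close>) decomposes \<open>F\<^sub>q\<^sup>N\<close>, where
  \<open>N = k\<^sub>1 + \<dots> + k\<^sub>n\<close>, as \<open>x = x\<^sub>1 \<oplus> \<dots> \<oplus> x\<^sub>n\<close> with \<open>x\<^sub>i \<in> F\<^sub>q^k\<^sub>i\<close>. Vectors are indexed from \<open>0\<close>,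
  so \<open>x\<^sub>i\<close> occupies the \<open>ks i\<close> positions starting at \<open>k\<^sub>1 + \<dots> + k\<^sub>i\<^sub>-\<^sub>1\<close>.\<close>

definition block :: "(nat \<Rightarrow> nat) \<Rightarrow> 'a vec \<Rightarrow> nat \<Rightarrow> 'a vec" where
  "block ks x i = vec (ks i) (\<lambda>s. x $ ((\<Sum>j\<in>{1..<i}. ks j) + s))"

definition block_supp :: "nat \<Rightarrow> (nat \<Rightarrow> nat) \<Rightarrow> 'a::{field,finite} vec \<Rightarrow> nat set" where
  "block_supp n ks x = {i \<in> {1..n}. block ks x i \<noteq> 0\<^sub>v (ks i)}"

definition pw_weight ::
  "nat \<Rightarrow> nat rel \<Rightarrow> ('a::{field,finite} \<Rightarrow> nat) \<Rightarrow> (nat \<Rightarrow> nat) \<Rightarrow> 'a vec \<Rightarrow> nat" where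
  "pw_weight n P w ks x =
     (let I = generated_ideal n P (block_supp n ks x); M = maximal_elements P I
      in (\<Sum>i\<in>M. block_weight w (block ks x i)) + card (I - M) * max_weight w)"

definition pw_dist ::
  "nat \<Rightarrow> nat rel \<Rightarrow> ('a::{field,finite} \<Rightarrow> nat) \<Rightarrow> (nat \<Rightarrow> nat) \<Rightarrow> 'a vec \<Rightarrow> 'a vec \<Rightarrow> nat" where
  "pw_dist n P w ks x y = pw_weight n P w ks (x - y)"

text \<open>Codes are arbitrary, not necessarily linear, subsets of \<open>carrier_vec N\<close>; the minimum below
  is meaningful when \<open>C\<close> has at least two elements.\<close>

definition min_dist ::
  "nat \<Rightarrow> nat rel \<Rightarrow> ('a::{field,finite} \<Rightarrow> nat) \<Rightarrow> (nat \<Rightarrow> nat) \<Rightarrow> 'a vec set \<Rightarrow> nat" where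
  "min_dist n P w ks C = Min {pw_dist n P w ks x y | x y. x \<in> C \<and> y \<in> C \<and> x \<noteq> y}"

definition ceil_log_card :: "'a::{field,finite} vec set \<Rightarrow> int" where
  "ceil_log_card C = \<lceil>log (real CARD('a)) (real (card C))\<rceil>"

text \<open>For a code with at least two words \<open>1 \<le> d \<le> n * max_weight w\<close>, so the subtraction \<open>d - 1\<close> does
  not truncate, \<open>div\<close> is the floor of the quotient, \<open>r < n\<close>, and there are ideals of cardinality \<open>r\<close>.\<close>

definition is_MDS ::
  "nat \<Rightarrow> nat rel \<Rightarrow> ('a::{field,finite} \<Rightarrow> nat) \<Rightarrow> (nat \<Rightarrow> nat) \<Rightarrow> 'a vec set \<Rightarrow> bool" where
  "is_MDS n P w ks C \<longleftrightarrow>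
     (let r = (min_dist n P w ks C - 1) div max_weight w
      in int (Max ((\<lambda>J. \<Sum>i\<in>J. ks i) ` ideals_of_card n P r))
           = int (\<Sum>i\<in>{1..n}. ks i) - ceil_log_card C)"

end

theory Submission
  imports Defs
begin

text \<open>Every ideal of cardinality \<open>r\<close> contributes the same value \<open>r * k\<close> to the maximum defining MDS,
  so the MDS condition says \<open>\<lceil>log\<^sub>q |C|\<rceil> / k = n - r\<close>, and the two bounds become
  \<open>M r + 1 \<le> d \<le> M (r + 1)\<close>, that is, \<open>r = \<lfloor>(d - 1) / M\<rfloor>\<close> with \<open>d \<ge> 1\<close>. What needs an argument is
  that the maximum is taken over a nonempty set: weights are at most \<open>n M\<close>, so \<open>r < n\<close>, and a poset
  on \<open>n\<close> points has ideals of every cardinality up to \<open>n\<close>.\<close>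

lemma is_ideal_whole:
  assumes "partial_order_on {1..n} P"
  shows "is_ideal n P {1..n}"
  using assms unfolding is_ideal_def partial_order_on_def preorder_on_def by auto

lemma generated_ideal_subset:
  assumes "partial_order_on {1..n} P" "A \<subseteq> {1..n}"
  shows "generated_ideal n P A \<subseteq> {1..n}"
  using is_ideal_whole[OF assms(1)] assms(2) unfolding generated_ideal_def by auto

lemma subset_generated_ideal: "A \<subseteq> generated_ideal n P A"
  unfolding generated_ideal_def by auto

lemma finite_ideals_of_card: "finite (ideals_of_card n P r)"
  by (rule finite_subset[of _ "Pow {1..n}"]) (auto simp: ideals_of_card_def is_ideal_def)

text \<open>Ideals grow one point at a time: a minimal element of the complement of an ideal has
  everything strictly below it inside the ideal already, so adjoining it gives an ideal
  again.\<close>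

lemma ideals_of_card_nonempty:
  assumes po: "partial_order_on {1..n} P" and "r \<le> n"
  shows "ideals_of_card n P r \<noteq> {}"
  using \<open>r \<le> n\<close>
proof (induction r)
  case 0
  have "{} \<in> ideals_of_card n P 0" by (auto simp: ideals_of_card_def is_ideal_def)
  then show ?case by auto
next
  case (Suc r)
  then obtain J where J: "is_ideal n P J" "card J = r"
    by (auto simp: ideals_of_card_def)
  have J_sub: "J \<subseteq> {1..n}" using J(1) by (auto simp: is_ideal_def)
  then have "finite J" by (rule finite_subset) simp
  have "{1..n} - J \<noteq> {}"
    using J(2) Suc.prems J_sub by (metis Diff_eq_empty_iff card_atLeastAtMost card_mono
        diff_Suc_1 \<open>finite J\<close> not_less_eq_eq)
  moreover have tr: "trans P" and an: "antisym P" and sub: "P \<subseteq> {1..n} \<times> {1..n}"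
    using po by (auto simp: partial_order_on_def preorder_on_def)
  \<comment> \<open>The strict part of the order is asymmetric and transitive, so it has a minimal
    element on the finite nonempty complement of \<open>J\<close>.\<close>
  let ?R = "\<lambda>i j. (i, j) \<in> P \<and> i \<noteq> j"
  have "asymp_on ({1..n} - J) ?R"
    using an by (intro asymp_onI) (auto dest: antisymD)
  moreover have "transp_on ({1..n} - J) ?R"
    using an tr by (intro transp_onI) (auto dest: antisymD transD)
  ultimately obtain m where m: "m \<in> {1..n} - J" "\<forall>i\<in>{1..n} - J. i \<noteq> m \<longrightarrow> \<not> ?R i m"
    using Finite_Set.bex_min_element[of "{1..n} - J" ?R] by blast
  \<comment> \<open>A point below \<open>m\<close> lies in \<open>{1..n}\<close> by
    \<open>sub\<close>; unless it is \<open>m\<close> itself, minimality of \<open>m\<close> puts it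
    in \<open>J\<close>.\<close>
  have "is_ideal n P (insert m J)"
    using J(1) m sub by (fastforce simp: is_ideal_def)
  moreover have "card (insert m J) = Suc r"
    using m(1) J(2) \<open>finite J\<close> by simp
  ultimately show ?case by (auto simp: ideals_of_card_def)
qed

lemma maximal_elements_subset: "maximal_elements P A \<subseteq> A"
  by (auto simp: maximal_elements_def)

lemma weight_le_max_weight: "w \<alpha> \<le> max_weight w"
  unfolding max_weight_def by (rule Max_ge) auto

lemma max_weight_pos:
  fixes w :: "'a::{field,finite} \<Rightarrow> nat"
  assumes "is_weight w"
  shows "0 < max_weight w"
proof -
  have "w 1 \<noteq> 0" using assms by (simp add: is_weight_def)
  then show ?thesis using weight_le_max_weight[of w 1] by linarith
qed

text \<open>Positive dimension keeps the \<open>Max\<close> away from the empty set, where its value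
  is unspecified.\<close>

lemma block_weight_le:
  assumes "0 < dim_vec v"
  shows "block_weight w v \<le> max_weight w"
  unfolding block_weight_def using assms by (subst Max_le_iff) (auto simp: weight_le_max_weight)

lemma block_weight_pos:
  assumes "is_weight w" "v \<noteq> 0\<^sub>v (dim_vec v)"
  shows "0 < block_weight w v"
proof -
  obtain s where s: "s < dim_vec v" "v $ s \<noteq> 0"
    using assms(2) by (metis eq_vecI index_zero_vec)
  have "0 < w (v $ s)" using assms(1) s(2) by (metis is_weight_def gr0I)
  also have "w (v $ s) \<le> block_weight w v"
    unfolding block_weight_def using s(1) by (intro Max_ge) auto
  finally show ?thesis .
qed

lemma dim_block [simp]: "dim_vec (block ks x i) = ks i"
  by (simp add: block_def)

lemma block_supp_nonempty:
  fixes x :: "'a::{field,finite} vec"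
  assumes ks: "\<forall>i\<in>{1..n}. ks i = k" and x: "x \<in> carrier_vec (n * k)" "x \<noteq> 0\<^sub>v (n * k)"
  shows "block_supp n ks x \<noteq> {}"
proof -
  obtain t where t: "t < n * k" "x $ t \<noteq> 0"
    using x by (metis carrier_vecD eq_vecI index_zero_vec)
  then have "0 < k" by (cases k) auto
  \<comment> \<open>Coordinates count from 0 but blocks from 1. The \<open>t div k\<close> blocks
    before block \<open>i\<close> fill \<open>(t div k) * k\<close> positions, so coordinate
    \<open>t\<close> sits in block \<open>i\<close> at offset \<open>t mod k\<close>.\<close>
  define i where "i = Suc (t div k)"
  have i: "i \<in> {1..n}"
    using t(1) by (simp add: i_def Suc_le_eq less_mult_imp_div_less)
  have "(\<Sum>j\<in>{1..<i}. ks j) = (\<Sum>j\<in>{1..<i}. k)"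
    using ks i by (intro sum.cong) auto
  then have "(\<Sum>j\<in>{1..<i}. ks j) + t mod k = t" by (simp add: i_def)
  then have "block ks x i $ (t mod k) \<noteq> 0"
    using t(2) ks i \<open>0 < k\<close> by (simp add: block_def)
  then have "block ks x i \<noteq> 0\<^sub>v (ks i)"
    using ks i \<open>0 < k\<close> by auto
  then show ?thesis using i by (auto simp: block_supp_def)
qed

text \<open>Each point of the generated ideal contributes at most \<open>max_weight w\<close>,
  whether maximal or not, and the ideal has at most \<open>n\<close> points.\<close>

lemma pw_weight_le:
  fixes w :: "'a::{field,finite} \<Rightarrow> nat"
  assumes po: "partial_order_on {1..n} P" and ks: "\<forall>i\<in>{1..n}. 0 < ks i"
  shows "pw_weight n P w ks x \<le> n * max_weight w"
proof -
  define I where "I = generated_ideal n P (block_supp n ks x)"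
  define M where "M = maximal_elements P I"
  have I: "I \<subseteq> {1..n}"
    unfolding I_def by (rule generated_ideal_subset[OF po]) (auto simp: block_supp_def)
  have fin: "finite I" using I by (rule finite_subset) simp
  have M: "M \<subseteq> I" unfolding M_def by (rule maximal_elements_subset)
  have "(\<Sum>i\<in>M. block_weight w (block ks x i)) \<le> card M * max_weight w"
    using sum_bounded_above[of M "\<lambda>i. block_weight w (block ks x i)" "max_weight w"]
      block_weight_le ks M I by fastforce
  then have "pw_weight n P w ks x \<le> card M * max_weight w + card (I - M) * max_weight w"
    by (simp add: pw_weight_def Let_def I_def M_def)
  also have "\<dots> = card I * max_weight w"
    using M fin by (simp add: card_Diff_subset finite_subset card_mono flip: add_mult_distrib)
  also have "\<dots> \<le> n * max_weight w"
    using card_mono[OF _ I] by simp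
  finally show ?thesis .
qed

lemma pw_weight_pos:
  fixes w :: "'a::{field,finite} \<Rightarrow> nat"
  assumes po: "partial_order_on {1..n} P" and w: "is_weight w" and supp: "block_supp n ks x \<noteq> {}"
  shows "0 < pw_weight n P w ks x"
proof -
  define I where "I = generated_ideal n P (block_supp n ks x)"
  define M where "M = maximal_elements P I"
  have pw: "pw_weight n P w ks x
      = (\<Sum>i\<in>M. block_weight w (block ks x i)) + card (I - M) * max_weight w"
    by (simp add: pw_weight_def Let_def I_def M_def)
  have "I \<subseteq> {1..n}"
    unfolding I_def by (rule generated_ideal_subset[OF po]) (auto simp: block_supp_def)
  then have fin: "finite I" by (rule finite_subset) simp
  show ?thesis
  \<comment> \<open>Splitting here avoids showing that maximal elements of \<open>I\<close> lie in
    the support: either all of \<open>I\<close> is maximal, including a support point with its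
    nonzero block, or some nonmaximal point contributes \<open>max_weight w\<close>.\<close>
  proof (cases "I - M = {}")
    case True
    then have "M = I" using maximal_elements_subset[of P I] M_def by auto
    obtain i where i: "i \<in> block_supp n ks x" using supp by auto
    then have "i \<in> M" using \<open>M = I\<close> subset_generated_ideal unfolding I_def by auto
    moreover have "0 < block_weight w (block ks x i)"
      using i by (intro block_weight_pos[OF w]) (simp add: block_supp_def)
    ultimately have "0 < (\<Sum>i\<in>M. block_weight w (block ks x i))"
      using fin \<open>M = I\<close> by (intro sum_pos2) auto
    then show ?thesis by (simp add: pw)
  next
    case False
    then have "0 < card (I - M)" using fin by (simp add: card_gt_0_iff)
    then show ?thesis using max_weight_pos[OF w] by (simp add: pw)
  qed
qed

text \<open>Two distinct words make the finite set of distances nonempty, so its \<open>Min\<close>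
  is a member. Bounds on the weight of a single nonzero vector thereby become bounds on the minimum
  distance.\<close>

lemma min_dist_attained:
  assumes "2 \<le> card C"
  obtains x y where "x \<in> C" "y \<in> C" "x \<noteq> y" "min_dist n P w ks C = pw_dist n P w ks x y"
proof -
  let ?D = "{pw_dist n P w ks x y | x y. x \<in> C \<and> y \<in> C \<and> x \<noteq> y}"
  have "finite C" using assms by (intro card_ge_0_finite) simp
  then have "finite ((\<lambda>(x, y). pw_dist n P w ks x y) ` (C \<times> C))" by simp
  then have "finite ?D" by (rule finite_subset[rotated]) auto
  moreover have "?D \<noteq> {}"
    using assms \<open>finite C\<close> card_le_Suc0_iff_eq[of C] by fastforce
  ultimately have "min_dist n P w ks C \<in> ?D"
    unfolding min_dist_def by (rule Min_in)
  then show ?thesis using that by auto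
qed

theorem theorem4p2:
  fixes n k N :: nat and P :: "nat rel" and ks :: "nat \<Rightarrow> nat"
    and w :: "'a::{field,finite} \<Rightarrow> nat" and C :: "'a vec set"
  assumes "partial_order_on {1..n} P"
    and "is_weight w"
    and "\<forall>i\<in>{1..n}. ks i = k"
    and "N = n * k"
    and "C \<subseteq> carrier_vec N"
    and "card C \<ge> 2"
    and "is_MDS n P w ks C"
  shows "real (max_weight w) * (real n - real_of_int (ceil_log_card C) / real k) + 1
           \<le> real (min_dist n P w ks C)
       \<and> real (min_dist n P w ks C)
           \<le> real (max_weight w) * (real n - real_of_int (ceil_log_card C) / real k + 1)"
proof -
  define M where "M = max_weight w"
  define d where "d = min_dist n P w ks C"
  define r where "r = (d - 1) div M"
  have "0 < M" unfolding M_def by (rule max_weight_pos[OF assms(2)])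
  obtain x y where xy: "x \<in> C" "y \<in> C" "x \<noteq> y" and d: "d = pw_weight n P w ks (x - y)"
    using min_dist_attained[OF assms(6)] unfolding d_def pw_dist_def by metis
  have car: "x \<in> carrier_vec (n * k)" "y \<in> carrier_vec (n * k)"
    using xy assms(4,5) by auto
  have diff: "x - y \<noteq> 0\<^sub>v (n * k)"
  proof
    assume eq: "x - y = 0\<^sub>v (n * k)"
    have "x $ t = y $ t" if "t < n * k" for t
      using arg_cong[OF eq, of "\<lambda>v. v $ t"] that car by simp
    with car \<open>x \<noteq> y\<close> show False by (metis carrier_vecD eq_vecI)
  qed
  \<comment> \<open>For \<open>n * k = 0\<close> the only vector is the empty one, which equals
    \<open>0\<^sub>v 0\<close>. Hence \<open>k\<close> is positive and may be divided by.\<close>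
  have "0 < n * k" using diff car by (intro gr0I) (auto intro!: eq_vecI)
  then have "0 < n" "0 < k" by auto
  have "block_supp n ks (x - y) \<noteq> {}"
    using car diff by (intro block_supp_nonempty[OF assms(3)]) auto
  then have "1 \<le> d"
    using pw_weight_pos[OF assms(1,2)] d by (simp add: Suc_le_eq)
  have "d \<le> n * M"
    unfolding d M_def using assms(3) \<open>0 < k\<close> by (intro pw_weight_le[OF assms(1)]) auto
  \<comment> \<open>Since \<open>d\<close> is at least 1, \<open>d - 1\<close> is strictly below
    \<open>n * M\<close>.\<close>
  then have "r < n"
    unfolding r_def using \<open>1 \<le> d\<close> by (intro less_mult_imp_div_less) linarith
  have "(\<Sum>i\<in>J. ks i) = r * k" if "J \<in> ideals_of_card n P r" for J
  proof -
    have "J \<subseteq> {1..n}" "card J = r" using that by (auto simp: ideals_of_card_def is_ideal_def)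
    then have "(\<Sum>i\<in>J. ks i) = (\<Sum>i\<in>J. k)" using assms(3) by (intro sum.cong) auto
    then show ?thesis using \<open>card J = r\<close> by simp
  qed
  \<comment> \<open>Existence of an ideal with \<open>r\<close> points makes the image exactly this
    singleton, so the \<open>Max\<close> in \<open>is_MDS\<close> is \<open>r * k\<close>.\<close>
  then have "(\<lambda>J. \<Sum>i\<in>J. ks i) ` ideals_of_card n P r = {r * k}"
    using ideals_of_card_nonempty[OF assms(1), of r] \<open>r < n\<close> by force
  moreover have "(\<Sum>i\<in>{1..n}. ks i) = n * k" using assms(3) by simp
  ultimately have "int (r * k) = int (n * k) - ceil_log_card C"
    using assms(7) by (simp add: is_MDS_def Let_def r_def d_def M_def)
  then have "ceil_log_card C = (int n - int r) * int k"
    by (simp add: left_diff_distrib)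
  then have "real_of_int (ceil_log_card C) = (real n - real r) * real k"
    by simp
  then have L: "real n - real_of_int (ceil_log_card C) / real k = real r"
    using \<open>0 < k\<close> by simp
  have "M * r \<le> d - 1" unfolding r_def by simp
  then have lo: "M * r + 1 \<le> d" using \<open>1 \<le> d\<close> by linarith
  \<comment> \<open>The remainder of \<open>d - 1\<close> modulo \<open>M\<close> is less than
    \<open>M\<close>.\<close>
  have "d - 1 < M * (r + 1)"
    unfolding r_def using dividend_less_times_div[OF \<open>0 < M\<close>, of "d - 1"] by simp
  then have hi: "d \<le> M * (r + 1)" by linarith
  have "real M * real r + 1 \<le> real d"
    using lo by (metis of_nat_1 of_nat_add of_nat_le_iff of_nat_mult)
  moreover have "real d \<le> real M * (real r + 1)"
    using hi by (metis of_nat_1 of_nat_add of_nat_le_iff of_nat_mult)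
  ultimately show ?thesis unfolding L M_def d_def by simp
qed

end
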